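(* (1) For all session automata $\mathcal A,\mathcal B$ there are session automata recognizing $L(\mathcal A)\cup L(\mathcal B)$ and $L(\mathcal A)\cap L(\mathcal B)$. (2) For every session automaton $\mathcal A$ with $k$ registers there is a session automaton $\mathcal A'$ with $k$ registers such that $L(\mathcal A')=\mathrm{Bounded}_k\setminus L(\mathcal A)$, where $\mathrm{Bounded}_k$ is the set of all $k$-bounded data words.
   Context: $\Sigma$ is a non-empty finite alphabet, $D$ an infinite set of data values; data words are elements of $(\Sigma\times D)^*$. A session automaton $(S,\mathcal R,\iota,F,\Delta)$ has finite non-empty state set $S$, finite non-empty register set $\mathcal R$ (its registers; "$k$ registers" means $|\mathcal R|=k$), initial state $\iota$, final states $F\subseteq S$, and finitely many transitions $(s,(a,\pi),s')$ with $a\in\Sigma$, $\pi\in\{r^\circledast,r^\uparrow:r\in\mathcal R\}$. Configurations are $(s,\tau,U)$ with $\tau:\mathcal R\rightharpoonup D$ partial, $U\subseteq D$. Reading $(a,d)$ via a transition on register $r$ requires $d=\tau(r)$ if $\pi=r^\uparrow$ and $d\notin U$ (global freshness) if $\pi=r^\circledast$; then $\tau(r):=d$, $U:=U\cup\{d\}$. Runs start in $(\iota,\emptyset,\emptyset)$; $L(\mathcal A)$ is the set of data words having a run ending in $F$. A session of $w=(a_1,d_1)\cdots(a_n,d_n)$ is a set $\{\mathrm{first}_w(d),\dots,\mathrm{last}_w(d)\}$, $d$ occurring in $w$, with $\mathrm{first}_w(d),\mathrm{last}_w(d)$ the first and last positions carrying $d$; $w$ is $k$-bounded if each position lies in at most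 $k$ sessions. *)

theory Defs
  imports Main
begin

type_synonym ('a, 'd) data_word = "('a \<times> 'd) list"

datatype 'r reg_op = Fresh 'r | Reuse 'r

record ('s, 'r, 'a) session_aut =
  states :: "'s set"
  registers :: "'r set"
  init :: 's
  final :: "'s set"
  transitions :: "('s \<times> ('a \<times> 'r reg_op) \<times> 's) set"

text \<open>The alphabet is the whole type \<^typ>\<open>'a\<close> (of class \<^class>\<open>finite\<close>); states and registers
  are carrier sets, so that automata of any finite size exist over a single type.\<close>

definition session_automaton :: "('s, 'r, 'a::finite) session_aut \<Rightarrow> bool" where
  "session_automaton A \<longleftrightarrow>
     finite (states A) \<and> states A \<noteq> {} \<and>
     finite (registers A) \<and> registers A \<noteq> {} \<and>
     init A \<in> states A \<and> final A \<subseteq> states A \<and>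
     finite (transitions A) \<and>
     transitions A \<subseteq> states A \<times> (UNIV \<times> (Fresh ` registers A \<union> Reuse ` registers A)) \<times> states A"

type_synonym ('s, 'r, 'd) config = "'s \<times> ('r \<rightharpoonup> 'd) \<times> 'd set"

inductive step ::
  "('s, 'r, 'a) session_aut \<Rightarrow> ('s, 'r, 'd) config \<Rightarrow> 'a \<times> 'd \<Rightarrow> ('s, 'r, 'd) config \<Rightarrow> bool"
  for A where
  step_reuse: "(s, (a, Reuse r), s') \<in> transitions A \<Longrightarrow> \<tau> r = Some d \<Longrightarrow>
     step A (s, \<tau>, U) (a, d) (s', \<tau>(r \<mapsto> d), U \<union> {d})"
| step_fresh: "(s, (a, Fresh r), s') \<in> transitions A \<Longrightarrow> d \<notin> U \<Longrightarrow>
     step A (s, \<tau>, U) (a, d) (s', \<tau>(r \<mapsto> d), U \<union> {d})"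

inductive run ::
  "('s, 'r, 'a) session_aut \<Rightarrow> ('s, 'r, 'd) config \<Rightarrow> ('a, 'd) data_word \<Rightarrow> ('s, 'r, 'd) config \<Rightarrow> bool"
  for A where
  run_Nil: "run A c [] c"
| run_Cons: "step A c x c' \<Longrightarrow> run A c' w c'' \<Longrightarrow> run A c (x # w) c''"

definition language :: "('s, 'r, 'a) session_aut \<Rightarrow> ('a, 'd) data_word set" where
  "language A = {w. \<exists>s \<tau> U. run A (init A, Map.empty, {}) w (s, \<tau>, U) \<and> s \<in> final A}"

text \<open>Positions of a word are list indices, counted from 0.\<close>

definition positions :: "('a, 'd) data_word \<Rightarrow> 'd \<Rightarrow> nat set" where
  "positions w d = {i. i < length w \<and> snd (w ! i) = d}"

definition first_pos :: "('a, 'd) data_word \<Rightarrow> 'd \<Rightarrow> nat" where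
  "first_pos w d = Min (positions w d)"

definition last_pos :: "('a, 'd) data_word \<Rightarrow> 'd \<Rightarrow> nat" where
  "last_pos w d = Max (positions w d)"

definition sessions :: "('a, 'd) data_word \<Rightarrow> nat set set" where
  "sessions w = {{first_pos w d..last_pos w d} | d. d \<in> snd ` set w}"

definition k_bounded :: "nat \<Rightarrow> ('a, 'd) data_word \<Rightarrow> bool" where
  "k_bounded k w \<longleftrightarrow> (\<forall>i < length w. card {I \<in> sessions w. i \<in> I} \<le> k)"

definition Bounded :: "nat \<Rightarrow> ('a, 'd) data_word set" where
  "Bounded k = {w. k_bounded k w}"

end

theory Submission
  imports Defs
begin

text \<open>Fix a run of an automaton \<open>C\<close> on a data word \<open>w\<close>. A run of another automaton \<open>B\<close> on \<open>w\<close> is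
  determined, as far as its future is concerned, by its state and by the matching that says
  which register of \<open>B\<close> holds the same value as which register of \<open>C\<close>: a value that \<open>C\<close> has
  overwritten never occurs again, and a value is fresh for \<open>B\<close> exactly if it is fresh for \<open>C\<close>.
  Matchings evolve according to the register operations performed by \<open>C\<close>, so \<open>C\<close> can carry along the
  set of all pairs (state, matching) reached by \<open>B\<close>; hence one can restrict the language of \<open>C\<close>
  to the words that \<open>B\<close> accepts, or to those that \<open>B\<close> rejects. Applied to the one-state
  automaton with \<open>k\<close> registers, whose language consists of the \<open>k\<close>-bounded words, this gives
  complements; intersections and unions follow.\<close>

section \<open>Runs\<close>

lemma run_Nil_iff [simp]: "run A c [] c' \<longleftrightarrow> c' = c"
  by (subst run.simps) auto

lemma run_Cons_iff: "run A c (x # w) c'' \<longleftrightarrow> (\<exists>c'. step A c x c' \<and> run A c' w c'')"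
  by (subst run.simps) blast

lemma run_append_iff: "run A c (u @ v) c'' \<longleftrightarrow> (\<exists>c'. run A c u c' \<and> run A c' v c'')"
proof (induction u arbitrary: c)
  case (Cons x u)
  then show ?case unfolding append_Cons run_Cons_iff by blast
qed simp

lemma run_snoc_iff: "run A c (w @ [x]) c'' \<longleftrightarrow> (\<exists>c'. run A c w c' \<and> step A c' x c'')"
  unfolding run_append_iff run_Cons_iff run_Nil_iff by blast

lemma step_iff:
  "step A (s, \<tau>, U) (a, d) (s', \<tau>', U') \<longleftrightarrow>
     U' = insert d U \<and>
     (\<exists>r. \<tau>' = \<tau>(r \<mapsto> d) \<and>
        ((s, (a, Reuse r), s') \<in> transitions A \<and> \<tau> r = Some d \<or>
         (s, (a, Fresh r), s') \<in> transitions A \<and> d \<notin> U))"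
  by (auto simp: step.simps)

abbreviation (input) init_run where
  "init_run A w s \<tau> U \<equiv> run A (init A, Map.empty, {}) w (s, \<tau>, U)"

lemma init_run_snoc_iff:
  "init_run A (w @ [x]) s' \<tau>' U' \<longleftrightarrow>
     (\<exists>s \<tau> U. init_run A w s \<tau> U \<and> step A (s, \<tau>, U) x (s', \<tau>', U'))"
  by (auto simp: run_snoc_iff)

text \<open>The used values depend only on the word, so all runs on it, of whatever automaton, agree
  on which values are fresh.\<close>

lemma init_run_used: "init_run A w s \<tau> U \<Longrightarrow> U = snd ` set w"
proof (induction w arbitrary: s \<tau> U rule: rev_induct)
  case (snoc x w)
  obtain a d where x: "x = (a, d)" by (cases x)
  obtain s0 \<tau>0 U0 where run: "init_run A w s0 \<tau>0 U0"
    and st: "step A (s0, \<tau>0, U0) (a, d) (s, \<tau>, U)"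
    using snoc.prems unfolding init_run_snoc_iff x by blast
  show ?case using snoc.IH[OF run] st by (simp add: step_iff x)
qed simp

text \<open>On reachable configurations the two kinds of step therefore exclude each other: a stored
  value cannot be read as fresh, and a fresh value is held by no register.\<close>

lemma init_run_stored: "init_run A w s \<tau> U \<Longrightarrow> \<tau> r = Some d \<Longrightarrow> d \<in> U"
proof (induction w arbitrary: s \<tau> U rule: rev_induct)
  case (snoc x w)
  obtain a e where x: "x = (a, e)" by (cases x)
  obtain s0 \<tau>0 U0 where run: "init_run A w s0 \<tau>0 U0"
    and st: "step A (s0, \<tau>0, U0) (a, e) (s, \<tau>, U)"
    using snoc.prems(1) unfolding init_run_snoc_iff x by blast
  show ?case using snoc.IH[OF run] snoc.prems(2) st by (auto simp: step_iff split: if_splits)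
qed simp

lemma init_run_state:
  assumes "session_automaton A" and "init_run A w s \<tau> U"
  shows "s \<in> states A"
  using assms(2)
proof (cases w rule: rev_cases)
  case (snoc w' x)
  then show ?thesis using assms
    by (cases x) (auto simp: init_run_snoc_iff step_iff session_automaton_def)
qed (use assms(1) in \<open>simp add: session_automaton_def\<close>)

lemma init_run_dom:
  assumes "session_automaton A" and "init_run A w s \<tau> U"
  shows "dom \<tau> \<subseteq> registers A"
  using assms(2)
proof (induction w arbitrary: s \<tau> U rule: rev_induct)
  case (snoc x w)
  obtain a d where x: "x = (a, d)" by (cases x)
  obtain s0 \<tau>0 U0 where run: "init_run A w s0 \<tau>0 U0"
    and st: "step A (s0, \<tau>0, U0) (a, d) (s, \<tau>, U)"
    using snoc.prems unfolding init_run_snoc_iff x by blast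
  have "transitions A \<subseteq> states A \<times> (UNIV \<times> (Fresh ` registers A \<union> Reuse ` registers A)) \<times> states A"
    using assms(1) by (simp add: session_automaton_def)
  then show ?case
    using snoc.IH[OF run] st by (fastforce simp: step_iff split: if_splits)
qed simp

text \<open>A used value is never fresh again, so its next occurrence is a reuse. Reading other
  values puts only those into registers, so the register that supplies it then holds it already
  now.\<close>

lemma run_reused_stored:
  assumes "run A (s, \<tau>, U) v c" and "d \<in> snd ` set v" and "d \<in> U"
  shows "\<exists>r. \<tau> r = Some d"
  using assms
proof (induction v arbitrary: s \<tau> U)
  case (Cons x v)
  obtain a e where x: "x = (a, e)" by (cases x)
  obtain s' \<tau>' U' where st: "step A (s, \<tau>, U) (a, e) (s', \<tau>', U')" and run: "run A (s', \<tau>', U') v c"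
    using Cons.prems(1) unfolding run_Cons_iff x by (metis prod_cases3)
  show ?case
  proof (cases "d = e")
    case True
    then show ?thesis using st Cons.prems(3) by (auto simp: step_iff)
  next
    case False
    then have "d \<in> snd ` set v" "d \<in> U'"
      using Cons.prems st by (auto simp: x step_iff)
    then obtain r where "\<tau>' r = Some d" using Cons.IH[OF run] by blast
    then show ?thesis using False st by (auto simp: step_iff split: if_splits)
  qed
qed simp

section \<open>Renaming states\<close>

definition map_states :: "('s \<Rightarrow> 't) \<Rightarrow> ('s, 'r, 'a) session_aut \<Rightarrow> ('t, 'r, 'a) session_aut" where
  "map_states f A = \<lparr>states = f ` states A, registers = registers A, init = f (init A),
     final = f ` final A, transitions = (\<lambda>(s, l, s'). (f s, l, f s')) ` transitions A\<rparr>"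

lemma map_states_sel [simp]:
  "registers (map_states f A) = registers A"
  "init (map_states f A) = f (init A)"
  by (simp_all add: map_states_def)

lemma session_automaton_map_states:
  assumes "session_automaton A"
  shows "session_automaton (map_states f A)"
proof -
  have "transitions (map_states f A) \<subseteq> states (map_states f A) \<times>
      (UNIV \<times> (Fresh ` registers A \<union> Reuse ` registers A)) \<times> states (map_states f A)"
  proof
    fix t assume "t \<in> transitions (map_states f A)"
    then obtain s a p s' where "t = (f s, (a, p), f s')" "(s, (a, p), s') \<in> transitions A"
      by (auto simp: map_states_def)
    moreover have "s \<in> states A" "s' \<in> states A" "p \<in> Fresh ` registers A \<union> Reuse ` registers A"
      using assms calculation(2) by (auto simp: session_automaton_def)
    ultimately show "t \<in> states (map_states f A) \<times>
        (UNIV \<times> (Fresh ` registers A \<union> Reuse ` registers A)) \<times> states (map_states f A)"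
      by (simp add: map_states_def)
  qed
  then show ?thesis
    using assms by (simp add: session_automaton_def map_states_def image_mono)
qed

text \<open>\<open>f\<close> is injective only on the carrier, but by \<open>init_run_state\<close>
  runs never leave it; so no two relevant states are merged and each renamed run comes from an
  original one.\<close>

lemma init_run_map_states:
  assumes A: "session_automaton A" and inj: "inj_on f (states A)"
  shows "init_run (map_states f A) w t \<tau> U \<longleftrightarrow> (\<exists>s. t = f s \<and> init_run A w s \<tau> U)"
proof (induction w arbitrary: t \<tau> U rule: rev_induct)
  case (snoc x w)
  obtain a d where x: "x = (a, d)" by (cases x)
  have tr: "(f s, l, t') \<in> transitions (map_states f A) \<longleftrightarrow>
      (\<exists>s'. t' = f s' \<and> (s, l, s') \<in> transitions A)"
    if s: "s \<in> states A" for s l t'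
  proof
    assume "(f s, l, t') \<in> transitions (map_states f A)"
    then obtain s0 s' where *: "f s = f s0" "t' = f s'" "(s0, l, s') \<in> transitions A"
      by (auto simp: map_states_def)
    moreover have "s0 \<in> states A" using A *(3) by (auto simp: session_automaton_def)
    ultimately show "\<exists>s'. t' = f s' \<and> (s, l, s') \<in> transitions A"
      using inj s by (metis inj_onD)
  qed (force simp: map_states_def)
  have st: "step (map_states f A) (f s, \<tau>0, U0) (a, d) (t, \<tau>, U) \<longleftrightarrow>
      (\<exists>s'. t = f s' \<and> step A (s, \<tau>0, U0) (a, d) (s', \<tau>, U))"
    if "init_run A w s \<tau>0 U0" for s \<tau>0 U0
    using init_run_state[OF A that] by (auto simp: step_iff tr)
  have "init_run (map_states f A) (w @ [x]) t \<tau> U \<longleftrightarrow>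
      (\<exists>s \<tau>0 U0. init_run A w s \<tau>0 U0 \<and> step (map_states f A) (f s, \<tau>0, U0) (a, d) (t, \<tau>, U))"
    unfolding run_snoc_iff x using snoc.IH by force
  also have "\<dots> \<longleftrightarrow> (\<exists>s \<tau>0 U0. init_run A w s \<tau>0 U0 \<and>
      (\<exists>s'. t = f s' \<and> step A (s, \<tau>0, U0) (a, d) (s', \<tau>, U)))"
    using st by blast
  finally show ?case by (auto simp: init_run_snoc_iff x)
qed auto

lemma language_map_states:
  assumes A: "session_automaton A" and inj: "inj_on f (states A)"
  shows "language (map_states f A) = language A"
proof -
  have "f s \<in> f ` final A \<longleftrightarrow> s \<in> final A" if "init_run A w s \<tau> U" for w s \<tau> U
    using init_run_state[OF A that] A inj_on_image_mem_iff[OF inj]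
    by (auto simp: session_automaton_def)
  moreover have "final (map_states f A) = f ` final A" by (simp add: map_states_def)
  ultimately show ?thesis
    unfolding language_def init_run_map_states[OF A inj] by blast
qed

text \<open>The tracking construction below enlarges the state type. Renumbering the finitely many
  states lets it be iterated at a fixed type.\<close>

lemma nat_states_exists:
  fixes A :: "('s, 'r, 'a::finite) session_aut"
  assumes "session_automaton A"
  obtains A' :: "(nat, 'r, 'a) session_aut"
  where "session_automaton A'" and "registers A' = registers A"
    and "(language A' :: ('a, 'd) data_word set) = language A"
proof -
  obtain f :: "'s \<Rightarrow> nat" where "inj_on f (states A)"
    using assms finite_imp_inj_to_nat_seg by (metis session_automaton_def)
  then show thesis
    using that[of "map_states f A"] assms
    by (simp add: session_automaton_map_states language_map_states)
qed

section \<open>Tracking the runs of a second automaton\<close>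

text \<open>The case \<open>\<sigma> q = None\<close> also covers a register \<open>q\<close> whose
  value is no longer held in \<open>\<rho>\<close>. Since \<open>\<sigma>\<close> is a function, the
  equivalence forces each value stored in \<open>\<tau>\<close> to occupy at most one register of
  \<open>\<rho>\<close>.\<close>

definition matching :: "('q \<rightharpoonup> 'd) \<Rightarrow> ('r \<rightharpoonup> 'd) \<Rightarrow> ('q \<rightharpoonup> 'r) \<Rightarrow> bool" where
  "matching \<tau> \<rho> \<sigma> \<longleftrightarrow> (\<forall>q r. \<sigma> q = Some r \<longleftrightarrow> (\<exists>d. \<tau> q = Some d \<and> \<rho> r = Some d))"

text \<open>A subset-construction step driven by the operation of \<open>C\<close> on its register
  \<open>r\<close>. On a reuse, exactly the registers linked to \<open>r\<close> hold the value
  read, and no content changes. On a fresh value the old content of \<open>r\<close> is lost, so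
  links to \<open>r\<close> are cut before \<open>q\<close> is linked to it.\<close>

fun track_next ::
  "('s, 'q, 'a) session_aut \<Rightarrow> 'a \<Rightarrow> 'r reg_op \<Rightarrow> ('s \<times> ('q \<rightharpoonup> 'r)) set \<Rightarrow> ('s \<times> ('q \<rightharpoonup> 'r)) set"
where
  "track_next B a (Reuse r) X =
     {(s', \<sigma>) | s s' \<sigma> q. (s, \<sigma>) \<in> X \<and> \<sigma> q = Some r \<and> (s, (a, Reuse q), s') \<in> transitions B}"
| "track_next B a (Fresh r) X =
     {(s', (\<lambda>p. if \<sigma> p = Some r then None else \<sigma> p)(q \<mapsto> r)) | s s' \<sigma> q.
        (s, \<sigma>) \<in> X \<and> (s, (a, Fresh q), s') \<in> transitions B}"

definition track_space ::
  "('c, 'r, 'a) session_aut \<Rightarrow> ('s, 'q, 'a) session_aut \<Rightarrow> ('s \<times> ('q \<rightharpoonup> 'r)) set" where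
  "track_space C B = states B \<times> {\<sigma>. dom \<sigma> \<subseteq> registers B \<and> ran \<sigma> \<subseteq> registers C}"

text \<open>The second component is a function of the letters read and the operations performed by
  \<open>C\<close>, and it summarises all runs of \<open>B\<close> at once. This is why rejection
  (\<open>b = False\<close>) can be tested on it as well as acceptance.\<close>

definition track ::
  "('c, 'r, 'a) session_aut \<Rightarrow> ('s, 'q, 'a) session_aut \<Rightarrow> bool \<Rightarrow>
     ('c \<times> ('s \<times> ('q \<rightharpoonup> 'r)) set, 'r, 'a) session_aut" where
  "track C B b = \<lparr>
     states = states C \<times> Pow (track_space C B),
     registers = registers C,
     init = (init C, {(init B, Map.empty)}),
     final = {(c, X). c \<in> final C \<and> X \<subseteq> track_space C B \<and> ((\<exists>(s, \<sigma>) \<in> X. s \<in> final B) \<longleftrightarrow> b)},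
     transitions = {((c, X), (a, p), (c', track_next B a p X)) | c X a p c'.
        (c, (a, p), c') \<in> transitions C \<and> X \<subseteq> track_space C B}\<rparr>"

lemma finite_track_space:
  assumes "session_automaton C" and "session_automaton B"
  shows "finite (track_space C B)"
proof -
  \<comment> \<open>Splitting by the exact domain leaves a finite union of sets of maps with fixed
    finite domain and finite range.\<close>
  have "{\<sigma>. dom \<sigma> \<subseteq> registers B \<and> ran \<sigma> \<subseteq> registers C}
      = (\<Union>R \<in> Pow (registers B). {\<sigma>. dom \<sigma> = R \<and> ran \<sigma> \<subseteq> registers C})"
    by auto
  moreover have "finite \<dots>"
    using assms by (auto simp: session_automaton_def intro!: finite_set_of_finite_maps
        intro: finite_subset)
  ultimately show ?thesis using assms(2) by (simp add: track_space_def session_automaton_def)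
qed

lemma track_next_space:
  assumes B: "session_automaton B" and X: "X \<subseteq> track_space C B"
    and p: "p \<in> Fresh ` registers C \<union> Reuse ` registers C"
  shows "track_next B a p X \<subseteq> track_space C B"
proof (cases p)
  case (Fresh r)
  have r: "r \<in> registers C" using p Fresh by auto
  show ?thesis
  proof
    fix y assume "y \<in> track_next B a p X"
    then obtain s s' \<sigma> q where y: "y = (s', (\<lambda>p. if \<sigma> p = Some r then None else \<sigma> p)(q \<mapsto> r))"
      and X': "(s, \<sigma>) \<in> X" and t: "(s, (a, Fresh q), s') \<in> transitions B"
      by (auto simp: Fresh)
    have "s' \<in> states B" "q \<in> registers B"
      using t B by (auto simp: session_automaton_def)
    moreover have "dom \<sigma> \<subseteq> registers B" "ran \<sigma> \<subseteq> registers C"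
      using X X' by (auto simp: track_space_def)
    ultimately show "y \<in> track_space C B"
      using r by (auto simp: y track_space_def ran_def split: if_splits)
  qed
next
  case (Reuse r)
  then show ?thesis using B X by (auto simp: track_space_def session_automaton_def)
qed

lemma session_automaton_track:
  assumes C: "session_automaton C" and B: "session_automaton B"
  shows "session_automaton (track C B b)"
proof -
  let ?D = "track C B b"
  have sub: "transitions ?D \<subseteq>
      states ?D \<times> (UNIV \<times> (Fresh ` registers ?D \<union> Reuse ` registers ?D)) \<times> states ?D"
  proof
    fix t assume "t \<in> transitions ?D"
    then obtain c X a p c' where t: "t = ((c, X), (a, p), (c', track_next B a p X))"
      and tC: "(c, (a, p), c') \<in> transitions C" and X: "X \<subseteq> track_space C B"
      by (auto simp: track_def)
    have "c \<in> states C" "c' \<in> states C" and p: "p \<in> Fresh ` registers C \<union> Reuse ` registers C"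
      using C tC by (auto simp: session_automaton_def)
    with track_next_space[OF B X p] X show
      "t \<in> states ?D \<times> (UNIV \<times> (Fresh ` registers ?D \<union> Reuse ` registers ?D)) \<times> states ?D"
      by (simp add: t track_def)
  qed
  have "finite (states ?D)"
    using C finite_track_space[OF C B] by (simp add: track_def session_automaton_def)
  moreover have "finite (registers ?D)" "registers ?D \<noteq> {}"
    using C by (simp_all add: track_def session_automaton_def)
  moreover have "finite (transitions ?D)"
    by (rule finite_subset[OF sub]) (use calculation in simp)
  moreover have "init ?D \<in> states ?D"
    using C B by (simp add: track_def track_space_def session_automaton_def)
  moreover have "final ?D \<subseteq> states ?D"
    using C by (auto simp: track_def session_automaton_def)
  ultimately show ?thesis using sub unfolding session_automaton_def by blast
qed

lemma track_transition_iff: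
  "((c, X), (a, p), (c', X')) \<in> transitions (track C B b) \<longleftrightarrow>
     (c, (a, p), c') \<in> transitions C \<and> X \<subseteq> track_space C B \<and> X' = track_next B a p X"
  by (auto simp: track_def)

lemma init_run_trackD: "init_run (track C B b) w (c, X) \<rho> U \<Longrightarrow> init_run C w c \<rho> U"
proof (induction w arbitrary: c X \<rho> U rule: rev_induct)
  case (snoc x w)
  obtain a d where x: "x = (a, d)" by (cases x)
  obtain c0 X0 \<rho>0 U0 where run: "init_run (track C B b) w (c0, X0) \<rho>0 U0"
    and st: "step (track C B b) ((c0, X0), \<rho>0, U0) (a, d) ((c, X), \<rho>, U)"
    using snoc.prems unfolding init_run_snoc_iff x by (metis surj_pair)
  have "step C (c0, \<rho>0, U0) (a, d) (c, \<rho>, U)"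
    using st unfolding step_iff track_transition_iff by blast
  then show ?case using snoc.IH[OF run] unfolding init_run_snoc_iff x by blast
qed (simp add: track_def)

text \<open>The successor of the second component always exists, and the guard
  \<open>X \<subseteq> track_space C B\<close> never blocks because reachable states lie in the
  carrier.\<close>

lemma init_run_trackI:
  assumes C: "session_automaton C" and B: "session_automaton B"
  shows "init_run C w c \<rho> U \<Longrightarrow> \<exists>X. init_run (track C B b) w (c, X) \<rho> U"
proof (induction w arbitrary: c \<rho> U rule: rev_induct)
  case (snoc x w)
  obtain a d where x: "x = (a, d)" by (cases x)
  obtain c0 \<rho>0 U0 where run: "init_run C w c0 \<rho>0 U0"
    and st: "step C (c0, \<rho>0, U0) (a, d) (c, \<rho>, U)"
    using snoc.prems unfolding init_run_snoc_iff x by blast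
  obtain X where X: "init_run (track C B b) w (c0, X) \<rho>0 U0" using snoc.IH[OF run] by blast
  have "X \<subseteq> track_space C B"
    using init_run_state[OF session_automaton_track[OF C B] X] by (simp add: track_def)
  then have "\<exists>X'. step (track C B b) ((c0, X), \<rho>0, U0) (a, d) ((c, X'), \<rho>, U)"
    using st unfolding step_iff track_transition_iff by blast
  then show ?case using X unfolding init_run_snoc_iff x by blast
qed (simp add: track_def)

section \<open>Correctness of the tracking construction\<close>

lemma matching_reuse_iff:
  "matching \<tau> \<rho> \<sigma> \<Longrightarrow> \<rho> r = Some d \<Longrightarrow> \<tau> q = Some d \<longleftrightarrow> \<sigma> q = Some r"
  by (auto simp: matching_def)

lemma matching_fresh:
  assumes "matching \<tau> \<rho> \<sigma>" and "d \<notin> ran \<tau>" and "d \<notin> ran \<rho>"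
  shows "matching (\<tau>(q \<mapsto> d)) (\<rho>(r \<mapsto> d)) ((\<lambda>p. if \<sigma> p = Some r then None else \<sigma> p)(q \<mapsto> r))"
proof -
  \<comment> \<open>A register \<open>p\<close> linked to \<open>r\<close> loses its link, so its
    value must sit in no other register of \<open>\<rho>\<close>; this is the uniqueness built into
    \<open>matching\<close>.\<close>
  have inj: "r' = r" if "\<rho> r = Some e" "\<rho> r' = Some e" "\<tau> p = Some e" for p r' e
    using assms(1) that unfolding matching_def by (metis option.inject)
  show ?thesis using assms by (auto simp: matching_def ran_def dest: inj)
qed

text \<open>Soundness and completeness of the tracked set: each pair must come from a real run of
  \<open>B\<close>, and each run must be seen, or else a word rejected by the set could still be
  accepted by \<open>B\<close>.\<close>

lemma track_invariant:
  assumes "init_run (track C B b) w (c, X) \<rho> U"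
  shows "(\<forall>s \<sigma>. (s, \<sigma>) \<in> X \<longrightarrow> (\<exists>\<tau>. init_run B w s \<tau> U \<and> matching \<tau> \<rho> \<sigma>)) \<and>
     (\<forall>s \<tau>. init_run B w s \<tau> U \<longrightarrow> (\<exists>\<sigma>. (s, \<sigma>) \<in> X \<and> matching \<tau> \<rho> \<sigma>))"
  using assms
proof (induction w arbitrary: c X \<rho> U rule: rev_induct)
  case Nil
  then show ?case by (auto simp: track_def matching_def)
next
  case (snoc x w)
  obtain a d where x: "x = (a, d)" by (cases x)
  obtain c0 X0 \<rho>0 U0 where run: "init_run (track C B b) w (c0, X0) \<rho>0 U0"
    and st: "step (track C B b) ((c0, X0), \<rho>0, U0) (a, d) ((c, X), \<rho>, U)"
    using snoc.prems unfolding init_run_snoc_iff x by (metis surj_pair)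
  note IH = snoc.IH[OF run]
  have U: "U = insert d U0" using st by (simp add: step_iff)
  have U0: "U0 = snd ` set w" using run by (rule init_run_used)
  \<comment> \<open>Used values depend only on the word, so every run of \<open>B\<close> on
    \<open>w\<close> arrives with the same set \<open>U0\<close> as the tracking run.\<close>
  have B_snoc: "init_run B (w @ [x]) s' \<tau>' U \<longleftrightarrow>
      (\<exists>s \<tau>. init_run B w s \<tau> U0 \<and> step B (s, \<tau>, U0) (a, d) (s', \<tau>', U))" for s' \<tau>'
    using init_run_used[of B w] unfolding init_run_snoc_iff x U0 by metis
  \<comment> \<open>In the reuse case \<open>r\<close> is overwritten with the value it already
    holds, so \<open>\<rho>\<close> does not change.\<close>
  from st consider
      (reuse) r where "\<rho>0 r = Some d" "\<rho> = \<rho>0" "X = track_next B a (Reuse r) X0"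
    | (fresh) r where "d \<notin> U0" "\<rho> = \<rho>0(r \<mapsto> d)" "X = track_next B a (Fresh r) X0"
    by (auto simp: step_iff track_transition_iff map_upd_triv)
  then show ?case
  proof cases
    case reuse
    have d: "d \<in> U0" using init_run_stored[OF run reuse(1)] .
    \<comment> \<open>As \<open>d\<close> is used, \<open>B\<close> cannot read it as fresh; it must
      reuse a register holding \<open>d\<close>, and those are exactly the ones matched to
      \<open>r\<close>.\<close>
    have B_step: "step B (s, \<tau>, U0) (a, d) (s', \<tau>', U) \<longleftrightarrow>
        \<tau>' = \<tau> \<and> (\<exists>q. (s, (a, Reuse q), s') \<in> transitions B \<and> \<sigma> q = Some r)"
      if "matching \<tau> \<rho>0 \<sigma>" for s \<tau> s' \<tau>' \<sigma>
      using d U matching_reuse_iff[OF that reuse(1)]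
      by (auto simp: step_iff map_upd_triv intro: map_upd_triv[symmetric])
    show ?thesis
    proof (intro conjI allI impI)
      fix s' \<sigma> assume "(s', \<sigma>) \<in> X"
      then obtain s q where *: "(s, \<sigma>) \<in> X0" "\<sigma> q = Some r" "(s, (a, Reuse q), s') \<in> transitions B"
        unfolding reuse(3) by auto
      then obtain \<tau> where "init_run B w s \<tau> U0" and m: "matching \<tau> \<rho>0 \<sigma>" using IH by blast
      then show "\<exists>\<tau>. init_run B (w @ [x]) s' \<tau> U \<and> matching \<tau> \<rho> \<sigma>"
        using B_step[OF m] * unfolding B_snoc reuse(2) by blast
    next
      fix s' \<tau>' assume "init_run B (w @ [x]) s' \<tau>' U"
      then obtain s \<tau> where r: "init_run B w s \<tau> U0" and sB: "step B (s, \<tau>, U0) (a, d) (s', \<tau>', U)"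
        unfolding B_snoc by blast
      obtain \<sigma> where "(s, \<sigma>) \<in> X0" and m: "matching \<tau> \<rho>0 \<sigma>" using IH r by blast
      then show "\<exists>\<sigma>. (s', \<sigma>) \<in> X \<and> matching \<tau>' \<rho> \<sigma>"
        using sB unfolding B_step[OF m] reuse(2,3) by auto
    qed
  next
    case fresh
    have B_step: "step B (s, \<tau>, U0) (a, d) (s', \<tau>', U) \<longleftrightarrow>
        (\<exists>q. \<tau>' = \<tau>(q \<mapsto> d) \<and> (s, (a, Fresh q), s') \<in> transitions B)"
      if "init_run B w s \<tau> U0" for s \<tau> s' \<tau>'
      using U fresh(1) init_run_stored[OF that] by (auto simp: step_iff)
    have m': "matching (\<tau>(q \<mapsto> d)) \<rho> ((\<lambda>p. if \<sigma> p = Some r then None else \<sigma> p)(q \<mapsto> r))"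
      if "init_run B w s \<tau> U0" "matching \<tau> \<rho>0 \<sigma>" for s \<tau> \<sigma> q
      unfolding fresh(2) using that fresh(1) init_run_stored[OF that(1)] init_run_stored[OF run]
      by (intro matching_fresh) (auto simp: ran_def)
    show ?thesis
    proof (intro conjI allI impI)
      fix s' \<sigma>' assume "(s', \<sigma>') \<in> X"
      then obtain s \<sigma> q where *: "(s, \<sigma>) \<in> X0" "(s, (a, Fresh q), s') \<in> transitions B"
        "\<sigma>' = (\<lambda>p. if \<sigma> p = Some r then None else \<sigma> p)(q \<mapsto> r)"
        unfolding fresh(3) by auto
      then obtain \<tau> where r: "init_run B w s \<tau> U0" and m: "matching \<tau> \<rho>0 \<sigma>" using IH by blast
      then show "\<exists>\<tau>. init_run B (w @ [x]) s' \<tau> U \<and> matching \<tau> \<rho> \<sigma>'"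
        using B_step[OF r] m'[OF r m] * unfolding B_snoc by blast
    next
      fix s' \<tau>' assume "init_run B (w @ [x]) s' \<tau>' U"
      then obtain s \<tau> where r: "init_run B w s \<tau> U0" and sB: "step B (s, \<tau>, U0) (a, d) (s', \<tau>', U)"
        unfolding B_snoc by blast
      obtain \<sigma> where X0: "(s, \<sigma>) \<in> X0" and m: "matching \<tau> \<rho>0 \<sigma>" using IH r by blast
      obtain q where q: "\<tau>' = \<tau>(q \<mapsto> d)" "(s, (a, Fresh q), s') \<in> transitions B"
        using sB unfolding B_step[OF r] by blast
      have "(s', (\<lambda>p. if \<sigma> p = Some r then None else \<sigma> p)(q \<mapsto> r)) \<in> X"
        unfolding fresh(3) using X0 q(2) by auto
      then show "\<exists>\<sigma>. (s', \<sigma>) \<in> X \<and> matching \<tau>' \<rho> \<sigma>"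
        using m'[OF r m] unfolding q(1) by blast
    qed
  qed
qed

lemma language_track:
  assumes C: "session_automaton C" and B: "session_automaton B"
  shows "language (track C B b) = {w \<in> language C. w \<in> language B \<longleftrightarrow> b}"
proof (rule set_eqI)
  fix w
  \<comment> \<open>The test on the second component has the same outcome on all runs over
    \<open>w\<close>, so the nondeterminism of \<open>C\<close> does no harm to rejection.\<close>
  have acc: "(c, X) \<in> final (track C B b) \<longleftrightarrow> c \<in> final C \<and> (w \<in> language B \<longleftrightarrow> b)"
    if run: "init_run (track C B b) w (c, X) \<rho> U" for c X \<rho> U
  proof -
    have "X \<subseteq> track_space C B"
      using init_run_state[OF session_automaton_track[OF C B] run] by (simp add: track_def)
    moreover have "(\<exists>(s, \<sigma>) \<in> X. s \<in> final B) \<longleftrightarrow> w \<in> language B"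
      using track_invariant[OF run] init_run_used[OF run] init_run_used[of B w]
      unfolding language_def by blast
    ultimately show ?thesis by (simp add: track_def)
  qed
  have "w \<in> language (track C B b) \<longleftrightarrow>
      (\<exists>c X \<rho> U. init_run (track C B b) w (c, X) \<rho> U \<and> c \<in> final C) \<and> (w \<in> language B \<longleftrightarrow> b)"
    unfolding language_def[of "track C B b"] using acc by (auto 0 4)
  also have "\<dots> \<longleftrightarrow> w \<in> language C \<and> (w \<in> language B \<longleftrightarrow> b)"
    using init_run_trackD[of C B b w] init_run_trackI[OF C B, of w] unfolding language_def[of C]
    by blast
  finally show "w \<in> language (track C B b) \<longleftrightarrow> w \<in> {w \<in> language C. w \<in> language B \<longleftrightarrow> b}" by simp
qed

lemma track_exists:
  fixes C :: "('c, 'r, 'a::finite) session_aut" and B :: "('s, 'q, 'a) session_aut"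
  assumes "session_automaton C" and "session_automaton B"
  obtains D :: "(nat, 'r, 'a) session_aut"
  where "session_automaton D" and "registers D = registers C"
    and "(language D :: ('a, 'd) data_word set) = {w \<in> language C. w \<in> language B \<longleftrightarrow> b}"
proof -
  have reg: "registers (track C B b) = registers C" by (simp add: track_def)
  obtain D :: "(nat, 'r, 'a) session_aut" where "session_automaton D"
    "registers D = registers (track C B b)"
    "(language D :: ('a, 'd) data_word set) = language (track C B b)"
    by (rule nat_states_exists[OF session_automaton_track[OF assms]])
  then show thesis by (intro that) (simp_all only: reg language_track[OF assms])
qed

section \<open>Bounded data words\<close>

lemma finite_positions [simp]: "finite (positions w d)"
  by (simp add: positions_def)

lemma positions_nonempty: "d \<in> snd ` set w \<Longrightarrow> positions w d \<noteq> {}"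
  by (force simp: positions_def in_set_conv_nth)

lemma first_pos_le_iff:
  assumes "d \<in> snd ` set w"
  shows "first_pos w d \<le> i \<longleftrightarrow> d \<in> snd ` set (take (Suc i) w)"
proof -
  have "first_pos w d \<le> i \<longleftrightarrow> (\<exists>j \<in> positions w d. j \<le> i)"
    unfolding first_pos_def using positions_nonempty[OF assms] by (simp add: Min_le_iff)
  also have "\<dots> \<longleftrightarrow> d \<in> snd ` set (take (Suc i) w)"
    by (force simp: positions_def in_set_conv_nth image_iff)
  finally show ?thesis .
qed

lemma last_pos_ge_iff:
  assumes "d \<in> snd ` set w"
  shows "i \<le> last_pos w d \<longleftrightarrow> d \<in> snd ` set (drop i w)"
proof -
  have "i \<le> last_pos w d \<longleftrightarrow> (\<exists>j \<in> positions w d. i \<le> j)"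
    unfolding last_pos_def using positions_nonempty[OF assms] by (simp add: Max_ge_iff)
  also have "\<dots> \<longleftrightarrow> (\<exists>j < length w. i \<le> j \<and> snd (w ! j) = d)"
    by (auto simp: positions_def)
  also have "\<dots> \<longleftrightarrow> d \<in> snd ` set (drop i w)"
  proof
    assume "\<exists>j < length w. i \<le> j \<and> snd (w ! j) = d"
    then obtain j where "j < length w" "i \<le> j" "snd (w ! j) = d" by blast
    then have "w ! j \<in> set (drop i w)"
      by (auto simp: in_set_conv_nth intro!: exI[of _ "j - i"])
    then show "d \<in> snd ` set (drop i w)" using \<open>snd (w ! j) = d\<close> by blast
  next
    assume "d \<in> snd ` set (drop i w)"
    then obtain j where "j < length w - i" "snd (w ! (i + j)) = d"
      by (auto simp: in_set_conv_nth)
    then show "\<exists>j < length w. i \<le> j \<and> snd (w ! j) = d"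
      by (intro exI[of _ "i + j"]) simp
  qed
  finally show ?thesis .
qed

lemma snd_nth_first_pos: "d \<in> snd ` set w \<Longrightarrow> snd (w ! first_pos w d) = d"
  using Min_in[OF finite_positions positions_nonempty, of d w]
  by (simp add: first_pos_def positions_def)

lemma first_le_last_pos: "d \<in> snd ` set w \<Longrightarrow> first_pos w d \<le> last_pos w d"
  unfolding first_pos_def last_pos_def
  using Min_in[OF finite_positions positions_nonempty, of d w] by (simp add: Max_ge)

text \<open>A session determines its value, namely the one at its left end, so sessions can be
  counted by values. Position \<open>i\<close> belongs to both factors because sessions include
  their end points.\<close>

lemma card_sessions_at:
  "card {I \<in> sessions w. i \<in> I} = card (snd ` set (take (Suc i) w) \<inter> snd ` set (drop i w))"
proof -
  let ?I = "\<lambda>d. {first_pos w d..last_pos w d}"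
  let ?V = "snd ` set (take (Suc i) w) \<inter> snd ` set (drop i w)"
  have V: "?V \<subseteq> snd ` set w" by (auto dest: in_set_takeD)
  have "d \<in> ?V \<longleftrightarrow> d \<in> snd ` set w \<and> i \<in> ?I d" for d
    using V first_pos_le_iff[of d w i] last_pos_ge_iff[of d w i] by auto
  then have "{I \<in> sessions w. i \<in> I} = ?I ` ?V"
    unfolding sessions_def by blast
  moreover have "inj_on ?I ?V"
  proof (rule inj_onI)
    fix d e assume "d \<in> ?V" "e \<in> ?V" and eq: "?I d = ?I e"
    then have *: "d \<in> snd ` set w" "e \<in> snd ` set w" using V by blast+
    \<comment> \<open>Equal intervals have equal end points once they are nonempty, which
      \<open>first_le_last_pos\<close> provides.\<close>
    then have "first_pos w d = first_pos w e"
      using eq first_le_last_pos[of _ w] by (simp add: Icc_eq_Icc)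
    then show "d = e" using snd_nth_first_pos * by metis
  qed
  ultimately show ?thesis by (simp add: card_image)
qed

text \<open>Position \<open>i\<close> becomes the split with \<open>length u = i\<close>. This form
  fits the splitting of runs.\<close>

lemma k_bounded_iff:
  "k_bounded k w \<longleftrightarrow>
     (\<forall>u x v. w = u @ x # v \<longrightarrow> card (snd ` set (u @ [x]) \<inter> snd ` set (x # v)) \<le> k)"
  unfolding k_bounded_def card_sessions_at
proof (intro iffI allI impI)
  fix u x v
  assume "\<forall>i<length w. card (snd ` set (take (Suc i) w) \<inter> snd ` set (drop i w)) \<le> k"
    and "w = u @ x # v"
  then show "card (snd ` set (u @ [x]) \<inter> snd ` set (x # v)) \<le> k"
    by (auto dest: spec[of _ "length u"])
next
  fix i
  assume *: "\<forall>u x v. w = u @ x # v \<longrightarrow> card (snd ` set (u @ [x]) \<inter> snd ` set (x # v)) \<le> k"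
    and i: "i < length w"
  show "card (snd ` set (take (Suc i) w) \<inter> snd ` set (drop i w)) \<le> k"
    using *[rule_format, OF id_take_nth_drop[OF i]]
    by (simp only: take_Suc_conv_app_nth[OF i] Cons_nth_drop_Suc[OF i])
qed

section \<open>Boundedness of recognized languages\<close>

lemma Bounded_mono: "k \<le> l \<Longrightarrow> Bounded k \<subseteq> Bounded l"
  by (auto simp: Bounded_def k_bounded_def intro: order_trans)

text \<open>After \<open>u @ [x]\<close> every value counted lies in a register: that of
  \<open>x\<close> was just written, and any other one is used and occurs again in \<open>v\<close>,
  so it must still be stored.\<close>

lemma language_subset_Bounded:
  assumes A: "session_automaton A"
  shows "language A \<subseteq> Bounded (card (registers A))"
proof
  fix w assume "w \<in> language A"
  then obtain s \<tau> U where run: "init_run A w s \<tau> U" by (auto simp: language_def)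
  have "card (snd ` set (u @ [x]) \<inter> snd ` set (x # v)) \<le> card (registers A)"
    if w: "w = u @ x # v" for u x v
  proof -
    obtain s1 \<tau>1 U1 where run1: "init_run A (u @ [x]) s1 \<tau>1 U1"
      and run2: "run A (s1, \<tau>1, U1) v (s, \<tau>, U)"
      using run run_append_iff[of A _ "u @ [x]" v] by (auto simp: w)
    have "snd x \<in> ran \<tau>1"
      using run1 by (cases x) (auto simp: init_run_snoc_iff step_iff intro: ranI)
    moreover have "d \<in> ran \<tau>1" if "d \<in> snd ` set (u @ [x])" "d \<in> snd ` set v" for d
      using run_reused_stored[OF run2 that(2)] that(1) init_run_used[OF run1] by (auto simp: ran_def)
    ultimately have "snd ` set (u @ [x]) \<inter> snd ` set (x # v) \<subseteq> ran \<tau>1" by auto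
    moreover have dom: "dom \<tau>1 \<subseteq> registers A" "finite (registers A)"
      using init_run_dom[OF A run1] A by (simp_all add: session_automaton_def)
    moreover have fin: "finite (dom \<tau>1)" using dom by (rule finite_subset)
    moreover have "ran \<tau>1 = (the \<circ> \<tau>1) ` dom \<tau>1" by (force simp: ran_def)
    ultimately have "card (snd ` set (u @ [x]) \<inter> snd ` set (x # v)) \<le> card (dom \<tau>1)"
      by (metis card_image_le card_mono finite_imageI order_trans)
    then show ?thesis using dom card_mono order_trans by blast
  qed
  then show "w \<in> Bounded (card (registers A))" unfolding Bounded_def k_bounded_iff by blast
qed

section \<open>The universal automaton with \<open>k\<close> registers\<close>

definition universal_aut :: "nat \<Rightarrow> (unit, nat, 'a) session_aut" where
  "universal_aut k = \<lparr>states = UNIV, registers = {..<k}, init = (), final = UNIV,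
     transitions = UNIV \<times> (UNIV \<times> (Fresh ` {..<k} \<union> Reuse ` {..<k})) \<times> UNIV\<rparr>"

lemma session_automaton_universal:
  "k > 0 \<Longrightarrow> session_automaton (universal_aut k :: (unit, nat, 'a::finite) session_aut)"
  by (auto simp: session_automaton_def universal_aut_def lessThan_empty_iff)

lemma registers_universal [simp]: "registers (universal_aut k) = {..<k}"
  by (simp add: universal_aut_def)

lemma step_universal_iff:
  "step (universal_aut k) (s, \<tau>, U) (a, d) (s', \<tau>', U') \<longleftrightarrow>
     U' = insert d U \<and> (\<exists>r < k. \<tau>' = \<tau>(r \<mapsto> d) \<and> (\<tau> r = Some d \<or> d \<notin> U))"
  by (auto simp: step_iff universal_aut_def)

text \<open>A fresh value goes into a register whose value does not occur any more; there is one, since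
  otherwise the position would lie in more than \<open>k\<close> sessions.\<close>

lemma run_universal_exists:
  assumes "k_bounded k (u @ v)"
    and "\<forall>d \<in> snd ` set u \<inter> snd ` set v. \<exists>r < k. \<tau> r = Some d"
  shows "\<exists>c. run (universal_aut k) ((), \<tau>, snd ` set u) v c"
  using assms
proof (induction v arbitrary: u \<tau>)
  case (Cons x v)
  obtain a d where x: "x = (a, d)" by (cases x)
  \<comment> \<open>The earlier values needed again after \<open>x\<close>; they must survive the
    register update.\<close>
  define L where "L = snd ` set u \<inter> snd ` set v"
  have "\<exists>r < k. (\<tau> r = Some d \<or> d \<notin> snd ` set u) \<and>
      (\<forall>e \<in> insert d L. \<exists>q < k. (\<tau>(r \<mapsto> d)) q = Some e)"
  proof (cases "d \<in> snd ` set u")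
    case True
    then obtain r where "r < k" "\<tau> r = Some d" using Cons.prems(2) by (auto simp: x)
    moreover have "\<forall>e \<in> insert d L. \<exists>q < k. \<tau> q = Some e"
      using Cons.prems(2) True by (auto simp: L_def x)
    ultimately show ?thesis by (metis map_upd_triv)
  next
    case False
    have "\<forall>e \<in> L. \<exists>r < k. \<tau> r = Some e" using Cons.prems(2) by (auto simp: L_def)
    then obtain g where g: "\<And>e. e \<in> L \<Longrightarrow> g e < k \<and> \<tau> (g e) = Some e" by metis
    have fin: "finite L" by (simp add: L_def)
    have "insert d L \<subseteq> snd ` set (u @ [x]) \<inter> snd ` set (x # v)" by (auto simp: L_def x)
    then have "card (insert d L) \<le> card (snd ` set (u @ [x]) \<inter> snd ` set (x # v))"
      by (intro card_mono) auto
    also have "\<dots> \<le> k" using Cons.prems(1) k_bounded_iff by blast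
    \<comment> \<open>Being fresh, \<open>d\<close> is not in \<open>L\<close> and takes one of the
      at most \<open>k\<close> places. Hence \<open>g\<close>, which picks a storing register for
      each value of \<open>L\<close>, misses some register, and overwriting that one loses nothing
      needed.\<close>
    finally have "card L < k" using False fin by (simp add: L_def)
    then have "card (g ` L) < card {..<k}" using card_image_le[OF fin, of g] by simp
    then have "\<not> {..<k} \<subseteq> g ` L" using card_mono[of "g ` L" "{..<k}"] fin by fastforce
    then obtain r where r: "r < k" "r \<notin> g ` L" by blast
    have "\<exists>q < k. (\<tau>(r \<mapsto> d)) q = Some e" if "e \<in> insert d L" for e
    proof (cases "e = d")
      case True
      then show ?thesis using r by auto
    next
      case False
      then have "e \<in> L" using that by simp
      then have "g e < k" "g e \<noteq> r" "\<tau> (g e) = Some e" using g r(2) by auto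
      then show ?thesis by (auto intro!: exI[of _ "g e"])
    qed
    then show ?thesis using False r by blast
  qed
  then obtain r where r: "r < k" "\<tau> r = Some d \<or> d \<notin> snd ` set u"
    "\<forall>e \<in> insert d L. \<exists>q < k. (\<tau>(r \<mapsto> d)) q = Some e" by blast
  have "\<forall>e \<in> snd ` set (u @ [x]) \<inter> snd ` set v. \<exists>q < k. (\<tau>(r \<mapsto> d)) q = Some e"
    using r(3) unfolding L_def x by (auto simp del: fun_upd_apply)
  then obtain c where "run (universal_aut k) ((), \<tau>(r \<mapsto> d), snd ` set (u @ [x])) v c"
    using Cons.IH[of "u @ [x]" "\<tau>(r \<mapsto> d)"] Cons.prems(1) 
    by (auto simp del: fun_upd_apply)
  moreover have "step (universal_aut k) ((), \<tau>, snd ` set u) x ((), \<tau>(r \<mapsto> d), snd ` set (u @ [x]))"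
    using r(1,2) by (auto simp: x step_universal_iff)
  ultimately show ?case using run_Cons by metis
qed simp

lemma language_universal:
  assumes "k > 0"
  shows "language (universal_aut k :: (unit, nat, 'a::finite) session_aut) = Bounded k"
proof
  show "language (universal_aut k :: (unit, nat, 'a) session_aut) \<subseteq> Bounded k"
    using language_subset_Bounded[OF session_automaton_universal[OF assms]] by simp
next
  show "Bounded k \<subseteq> language (universal_aut k :: (unit, nat, 'a) session_aut)"
    \<comment> \<open>With nothing read yet, the storage condition is vacuous.\<close>
    using run_universal_exists[of k "[]" _ Map.empty]
    by (auto simp: language_def Bounded_def universal_aut_def)
qed

section \<open>Closure properties\<close>

text \<open>Rejection by \<open>A\<close> is tracked along the universal automaton, whose registers
  are kept; so \<open>k\<close> can be any positive number, whatever the number of registers of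
  \<open>A\<close>.\<close>

lemma bounded_complement_exists:
  fixes A :: "('s, 'r, 'a::finite) session_aut"
  assumes "session_automaton A" and "k > 0"
  obtains A' :: "(nat, nat, 'a) session_aut"
  where "session_automaton A'" and "registers A' = {..<k}"
    and "(language A' :: ('a, 'd) data_word set) = Bounded k - language A"
proof (rule track_exists[OF session_automaton_universal[OF assms(2)] assms(1), of False])
  fix D :: "(nat, nat, 'a) session_aut"
  assume "session_automaton D" "registers D = registers (universal_aut k)"
    "(language D :: ('a, 'd) data_word set) =
      {w \<in> language (universal_aut k). (w \<in> language A) = False}"
  then show thesis by (intro that) (auto simp: language_universal[OF assms(2)])
qed

text \<open>Acceptance by \<open>B\<close> is tracked along \<open>A\<close>, so the result inherits
  the registers of \<open>A\<close> and their type.\<close>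

lemma language_Int_exists:
  fixes A :: "('s, 'r, 'a::finite) session_aut" and B :: "('t, 'q, 'a) session_aut"
  assumes "session_automaton A" and "session_automaton B"
  obtains C :: "(nat, 'r, 'a) session_aut"
  where "session_automaton C"
    and "(language C :: ('a, 'd) data_word set) = language A \<inter> language B"
proof (rule track_exists[OF assms, of True])
  fix D :: "(nat, 'r, 'a) session_aut"
  assume "session_automaton D"
    "(language D :: ('a, 'd) data_word set) = {w \<in> language A. (w \<in> language B) = True}"
  then show thesis by (intro that) auto
qed

theorem theorem3p8:
  assumes "infinite (UNIV :: 'd set)"
  shows
    "(\<forall>(A :: ('s1, 'r1, 'a::finite) session_aut) (B :: ('s2, 'r2, 'a) session_aut).
        session_automaton A \<longrightarrow> session_automaton B \<longrightarrow>
          (\<exists>C :: (nat, nat, 'a) session_aut. session_automaton C \<and>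
             (language C :: ('a, 'd) data_word set) = language A \<union> language B) \<and>
          (\<exists>C :: (nat, nat, 'a) session_aut. session_automaton C \<and>
             (language C :: ('a, 'd) data_word set) = language A \<inter> language B)) \<and>
     (\<forall>(A :: ('s, 'r, 'a) session_aut) (k :: nat).
        session_automaton A \<longrightarrow> card (registers A) = k \<longrightarrow>
          (\<exists>A' :: (nat, nat, 'a) session_aut. session_automaton A' \<and> card (registers A') = k \<and>
             (language A' :: ('a, 'd) data_word set) = Bounded k - language A))"
proof (intro conjI allI impI)
  fix A :: "('s1, 'r1, 'a) session_aut" and B :: "('s2, 'r2, 'a) session_aut"
  assume A: "session_automaton A" and B: "session_automaton B"
  \<comment> \<open>With the larger register count both languages lie in \<open>Bounded k\<close>,
    so complementing twice inside it gives them back.\<close>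
  define k where "k = max (card (registers A)) (card (registers B))"
  have k: "k > 0" using A by (auto simp: k_def session_automaton_def card_gt_0_iff less_max_iff_disj)
  have sub: "(language A :: ('a, 'd) data_word set) \<subseteq> Bounded k"
    "(language B :: ('a, 'd) data_word set) \<subseteq> Bounded k"
    using language_subset_Bounded[OF A] language_subset_Bounded[OF B]
      Bounded_mono[of "card (registers A)" k] Bounded_mono[of "card (registers B)" k]
    unfolding k_def by force+
  obtain A' :: "(nat, nat, 'a) session_aut" where A': "session_automaton A'"
    "(language A' :: ('a, 'd) data_word set) = Bounded k - language A"
    by (rule bounded_complement_exists[OF A k])
  obtain B' :: "(nat, nat, 'a) session_aut" where B': "session_automaton B'"
    "(language B' :: ('a, 'd) data_word set) = Bounded k - language B"
    by (rule bounded_complement_exists[OF B k])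
  obtain C' :: "(nat, nat, 'a) session_aut" where C': "session_automaton C'"
    "(language C' :: ('a, 'd) data_word set) = language A' \<inter> language B'"
    by (rule language_Int_exists[OF A'(1) B'(1)])
  \<comment> \<open>De Morgan inside \<open>Bounded k\<close>: the union is the complement of the
    intersection of the complements.\<close>
  obtain C :: "(nat, nat, 'a) session_aut" where C: "session_automaton C"
    "(language C :: ('a, 'd) data_word set) = Bounded k - language C'"
    by (rule bounded_complement_exists[OF C'(1) k])
  have "(language C :: ('a, 'd) data_word set) = language A \<union> language B"
    using sub by (auto simp: C(2) C'(2) A'(2) B'(2))
  with C(1) show "\<exists>C :: (nat, nat, 'a) session_aut. session_automaton C \<and>
      (language C :: ('a, 'd) data_word set) = language A \<union> language B" by blast
  \<comment> \<open>The double complement recognizes \<open>language A\<close> again, but with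
    registers of type \<open>nat\<close>, which the intersection then inherits.\<close>
  obtain E' :: "(nat, nat, 'a) session_aut" where E': "session_automaton E'"
    "(language E' :: ('a, 'd) data_word set) = Bounded k - language A'"
    by (rule bounded_complement_exists[OF A'(1) k])
  obtain E :: "(nat, nat, 'a) session_aut" where E: "session_automaton E"
    "(language E :: ('a, 'd) data_word set) = language E' \<inter> language B"
    by (rule language_Int_exists[OF E'(1) B])
  have "(language E :: ('a, 'd) data_word set) = language A \<inter> language B"
    using sub by (auto simp: E(2) E'(2) A'(2))
  with E(1) show "\<exists>C :: (nat, nat, 'a) session_aut. session_automaton C \<and>
      (language C :: ('a, 'd) data_word set) = language A \<inter> language B" by blast
next
  fix A :: "('s, 'r, 'a) session_aut" and k
  assume A: "session_automaton A" and "card (registers A) = k"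
  then have k: "k > 0" by (auto simp: session_automaton_def card_gt_0_iff)
  obtain A' :: "(nat, nat, 'a) session_aut" where "session_automaton A'" "registers A' = {..<k}"
    "(language A' :: ('a, 'd) data_word set) = Bounded k - language A"
    by (rule bounded_complement_exists[OF A k])
  then show "\<exists>A' :: (nat, nat, 'a) session_aut. session_automaton A' \<and> card (registers A') = k \<and>
      (language A' :: ('a, 'd) data_word set) = Bounded k - language A"
    by (intro exI[of _ A']) simp
qed

end
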